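(* For every tree $T$ of order $n\ge 3$, $$c_5(T) \ge cp_5(T) \ge \frac{n+3}{2},$$ and this is best possible, in the sense that there are trees of arbitrarily large order $n$ for which $c_5(T) = cp_5(T) = (n+3)/2$.
   Context: All graphs are finite, simple and undirected; the order of a graph is its number of vertices. A coloring assigns a color to each vertex; it is proper if adjacent vertices receive different colors. A subgraph (not necessarily induced) is rainbow if all its vertices receive pairwise different colors. $P_5$ is the path on $5$ vertices. $c_5(G)$ is the maximum number of different colors used in a (not necessarily proper) coloring of the vertices of $G$ having no rainbow subgraph isomorphic to $P_5$; $cp_5(G)$ is the maximum number of different colors used in a proper coloring of the vertices of $G$ having no rainbow subgraph isomorphic to $P_5$ (such a coloring always exists for trees). *)

theory Defs
  imports Complex_Main
begin

text \<open>A graph is a pair of a vertex set and an edge set, an edge being a two-element set of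
  vertices.\<close>

type_synonym 'a graph = "'a set \<times> 'a set set"

abbreviation verts :: "'a graph \<Rightarrow> 'a set" where
  "verts \<equiv> fst"

abbreviation edges :: "'a graph \<Rightarrow> 'a set set" where
  "edges \<equiv> snd"

abbreviation adjacent :: "'a graph \<Rightarrow> 'a \<Rightarrow> 'a \<Rightarrow> bool" where
  "adjacent G u v \<equiv> {u, v} \<in> edges G"

definition simple_graph :: "'a graph \<Rightarrow> bool" where
  "simple_graph G \<longleftrightarrow> finite (verts G) \<and>
     (\<forall>e\<in>edges G. \<exists>u\<in>verts G. \<exists>v\<in>verts G. u \<noteq> v \<and> e = {u, v})"

definition subgraph :: "'a graph \<Rightarrow> 'a graph \<Rightarrow> bool" where
  "subgraph H G \<longleftrightarrow> simple_graph H \<and> verts H \<subseteq> verts G \<and> edges H \<subseteq> edges G"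

definition graph_iso :: "'a graph \<Rightarrow> 'b graph \<Rightarrow> bool" where
  "graph_iso G H \<longleftrightarrow> (\<exists>f. bij_betw f (verts G) (verts H) \<and>
     (\<forall>u\<in>verts G. \<forall>v\<in>verts G. adjacent G u v \<longleftrightarrow> adjacent H (f u) (f v)))"

definition graph_connected :: "'a graph \<Rightarrow> bool" where
  "graph_connected G \<longleftrightarrow> verts G \<noteq> {} \<and>
     (\<forall>u\<in>verts G. \<forall>v\<in>verts G. (adjacent G)\<^sup>*\<^sup>* u v)"

definition graph_cycle :: "'a graph \<Rightarrow> 'a list \<Rightarrow> bool" where
  "graph_cycle G xs \<longleftrightarrow> length xs \<ge> 3 \<and> distinct xs \<and> set xs \<subseteq> verts G \<and>
     successively (adjacent G) xs \<and> adjacent G (last xs) (hd xs)"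

definition is_tree :: "'a graph \<Rightarrow> bool" where
  "is_tree G \<longleftrightarrow> simple_graph G \<and> graph_connected G \<and> (\<nexists>xs. graph_cycle G xs)"

text \<open>The path on \<open>k\<close> vertices, so with \<open>k - 1\<close> edges.\<close>

definition path_graph :: "nat \<Rightarrow> nat graph" where
  "path_graph k = ({..<k}, {{i, Suc i} | i. Suc i < k})"

text \<open>Colors are natural numbers. Only the values of a coloring on the vertex set matter, and
  the colors used are those in the image of the vertex set.\<close>

definition proper_coloring :: "'a graph \<Rightarrow> ('a \<Rightarrow> nat) \<Rightarrow> bool" where
  "proper_coloring G c \<longleftrightarrow>
     (\<forall>u\<in>verts G. \<forall>v\<in>verts G. adjacent G u v \<longrightarrow> c u \<noteq> c v)"

definition rainbow :: "('a \<Rightarrow> nat) \<Rightarrow> 'a graph \<Rightarrow> bool" where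
  "rainbow c H \<longleftrightarrow> inj_on c (verts H)"

definition no_rainbow_path :: "nat \<Rightarrow> 'a graph \<Rightarrow> ('a \<Rightarrow> nat) \<Rightarrow> bool" where
  "no_rainbow_path k G c \<longleftrightarrow>
     (\<nexists>H. subgraph H G \<and> graph_iso H (path_graph k) \<and> rainbow c H)"

definition c_num :: "nat \<Rightarrow> 'a graph \<Rightarrow> nat" where
  "c_num k G = Max {card (c ` verts G) | c. no_rainbow_path k G c}"

text \<open>If \<open>G\<close> has no proper coloring without a rainbow path on \<open>k\<close> vertices, this is the
  unspecified value \<open>Max {}\<close>; for \<open>k = 5\<close> and \<open>G\<close> a tree such a coloring exists.\<close>

definition cp_num :: "nat \<Rightarrow> 'a graph \<Rightarrow> nat" where
  "cp_num k G = Max {card (c ` verts G) | c. proper_coloring G c \<and> no_rainbow_path k G c}"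

lemma finite_color_counts:
  assumes "simple_graph G"
  shows "finite {card (c ` verts G) | c. P c}"
proof (rule finite_subset)
  show "{card (c ` verts G) | c. P c} \<subseteq> {..card (verts G)}"
    using assms by (auto simp: simple_graph_def card_image_le)
qed simp

end

theory Submission
  imports Defs
begin

text \<open>A path on five vertices meets each class of the bipartition of a tree at least twice, and it
  meets one of them three times. So give all vertices of one class \<open>A\<close> the same color and all other
  vertices private colors; one may moreover give a private color to a leaf \<open>v \<in> A\<close>, because \<open>v\<close> can
  only be an end of such a path, which then contains two further vertices of \<open>A\<close>. Choosing \<open>A\<close>
  suitably among the two classes yields \<open>(n + 3) / 2\<close> colors.

  For sharpness take \<open>k\<close> paths of length two with a common end: any two of these legs form a path on
  five vertices. If the center and some leg have three different colors, then every other leg brings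
  at most one new color, for a total of at most \<open>k + 2\<close>, where \<open>n = 2 k + 1\<close>.\<close>

section \<open>Adjacency, and rainbow paths as vertex lists\<close>

lemma adjacent_sym: "adjacent G u v \<longleftrightarrow> adjacent G v u"
  by (simp add: insert_commute)

lemma simple_graph_adjacent:
  assumes "simple_graph G" "adjacent G u v"
  shows "u \<in> verts G" "v \<in> verts G" "u \<noteq> v"
proof -
  obtain x y where "x \<in> verts G" "y \<in> verts G" "x \<noteq> y" "{u, v} = {x, y}"
    using assms unfolding simple_graph_def by blast
  then show "u \<in> verts G" "v \<in> verts G" "u \<noteq> v"
    by (auto simp: doubleton_eq_iff)
qed

text \<open>Trades subgraphs and isomorphisms for vertex lists. The inverse of an isomorphism onto
  the path lists the vertices in order; conversely, distinct colors already force the listed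
  vertices to be distinct, so the list spans a path.\<close>

lemma no_rainbow_path_iff:
  assumes "simple_graph G"
  shows "no_rainbow_path k G c \<longleftrightarrow>
    (\<nexists>xs. length xs = k \<and> set xs \<subseteq> verts G \<and> successively (adjacent G) xs \<and> distinct (map c xs))"
proof -
  have "\<exists>xs. length xs = k \<and> set xs \<subseteq> verts G \<and> successively (adjacent G) xs \<and> distinct (map c xs)"
    if H: "subgraph H G" "graph_iso H (path_graph k)" "rainbow c H" for H
  proof -
    obtain f where f: "bij_betw f (verts H) {..<k}"
      and adj: "\<And>u v. u \<in> verts H \<Longrightarrow> v \<in> verts H \<Longrightarrow>
        adjacent H u v \<longleftrightarrow> {f u, f v} \<in> edges (path_graph k)"
      using H(2) unfolding graph_iso_def by (auto simp: path_graph_def)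
    define g where "g = inv_into (verts H) f"
    have g: "bij_betw g {..<k} (verts H)" and fg: "\<And>i. i < k \<Longrightarrow> f (g i) = i"
      using f unfolding g_def by (auto simp: bij_betw_inv_into bij_betw_inv_into_right)
    have gH: "g i \<in> verts H" if "i < k" for i
      using g that by (auto simp: bij_betw_def)
    let ?xs = "map g [0..<k]"
    have "adjacent G (g i) (g (Suc i))" if "Suc i < k" for i
    proof -
      have "adjacent H (g i) (g (Suc i))"
        using that by (subst adj) (auto simp: gH fg path_graph_def)
      then show ?thesis using H(1) by (auto simp: subgraph_def)
    qed
    then have "successively (adjacent G) ?xs"
      by (auto simp: successively_conv_nth)
    moreover have "set ?xs = verts H"
      using g by (auto simp: bij_betw_def atLeast0LessThan)
    moreover have "distinct (map c ?xs)"
      using g H(3) unfolding distinct_map by (auto simp: bij_betw_def atLeast0LessThan rainbow_def)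
    ultimately show ?thesis
      using H(1) by (intro exI[of _ ?xs]) (auto simp: subgraph_def)
  qed
  moreover have "\<exists>H. subgraph H G \<and> graph_iso H (path_graph k) \<and> rainbow c H"
    if xs: "length xs = k" "set xs \<subseteq> verts G" "successively (adjacent G) xs" "distinct (map c xs)" for xs
  proof -
    \<comment> \<open>Only consecutive pairs become edges: a chord of \<open>G\<close> between
      vertices of \<open>xs\<close> would spoil the isomorphism.\<close>
    define H where "H = (set xs, {{xs ! i, xs ! Suc i} | i. Suc i < k})"
    have d: "distinct xs" and inj: "inj_on c (set xs)"
      using xs(4) by (auto simp: distinct_map)
    have "xs ! i \<noteq> xs ! Suc i" if "Suc i < k" for i
      using that d xs(1) by (simp add: nth_eq_iff_index_eq)
    then have "simple_graph H"
      using xs(1) unfolding simple_graph_def H_def by fastforce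
    moreover have "edges H \<subseteq> edges G"
      using xs(1,3) unfolding H_def by (auto simp: successively_conv_nth)
    ultimately have "subgraph H G"
      using xs(2) by (auto simp: subgraph_def H_def)
    moreover have "graph_iso H (path_graph k)"
    proof -
      have b: "bij_betw ((!) xs) {..<k} (set xs)"
        using d xs(1) by (simp add: bij_betw_nth)
      let ?f = "inv_into {..<k} ((!) xs)"
      have "bij_betw ?f (set xs) {..<k}"
        using b by (rule bij_betw_inv_into)
      moreover have "adjacent H u v \<longleftrightarrow> adjacent (path_graph k) (?f u) (?f v)"
        if uv: "u \<in> set xs" "v \<in> set xs" for u v
      proof -
        obtain i j where ij: "i < k" "j < k" "u = xs ! i" "v = xs ! j"
          using uv xs(1) by (metis in_set_conv_nth)
        have f: "?f u = i" "?f v = j"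
          using ij b by (auto simp: bij_betw_inv_into_left)
        have "{xs ! i, xs ! j} = {xs ! m, xs ! Suc m} \<longleftrightarrow> {i, j} = {m, Suc m}" if "Suc m < k" for m
          using that ij d xs(1) by (auto simp: doubleton_eq_iff nth_eq_iff_index_eq)
        then show ?thesis
          unfolding f unfolding ij H_def path_graph_def by auto
      qed
      ultimately show ?thesis
        unfolding graph_iso_def by (auto simp: H_def path_graph_def)
    qed
    ultimately show ?thesis
      using inj by (auto simp: rainbow_def H_def)
  qed
  ultimately show ?thesis
    unfolding no_rainbow_path_def by blast
qed

section \<open>Leaves and bipartitions of forests\<close>

text \<open>Take the first vertex of a longest path. By maximality all its neighbors lie on the
  path, and a neighbor beyond the second vertex would close a cycle. Isolated vertices count as
  leaves here.\<close>

lemma forest_leaf: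
  assumes G: "simple_graph G" and acyclic: "\<nexists>xs. graph_cycle G xs" and "verts G \<noteq> {}"
  shows "\<exists>v\<in>verts G. \<forall>u w. adjacent G v u \<longrightarrow> adjacent G v w \<longrightarrow> u = w"
proof -
  let ?P = "\<lambda>xs. xs \<noteq> [] \<and> distinct xs \<and> set xs \<subseteq> verts G \<and> successively (adjacent G) xs"
  have fin: "finite (verts G)" using G by (simp add: simple_graph_def)
  obtain x where "x \<in> verts G" using assms(3) by auto
  then have "?P [x]" by simp
  moreover have "\<forall>xs. ?P xs \<longrightarrow> length xs < Suc (card (verts G))"
    using fin by (metis card_mono distinct_card less_Suc_eq_le)
  ultimately have "\<exists>xs. ?P xs \<and> (\<forall>ys. ?P ys \<longrightarrow> length ys \<le> length xs)"
    by (rule Lattices_Big.ex_has_greatest_nat)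
  then obtain xs where P: "?P xs" and longest: "\<And>ys. ?P ys \<Longrightarrow> length ys \<le> length xs"
    by (elim exE conjE) simp
  obtain v ys where xs: "xs = v # ys" using P by (cases xs) auto
  have "u = hd ys" if u: "adjacent G v u" for u
  proof -
    have uV: "u \<in> verts G" "u \<noteq> v" using simple_graph_adjacent[OF G u] by auto
    have "u \<in> set xs"
    proof (rule ccontr)
      assume "u \<notin> set xs"
      then have "?P (u # xs)"
        using P uV u by (auto simp: xs insert_commute)
      from longest[OF this] show False by simp
    qed
    then obtain as bs where ys: "ys = as @ u # bs"
      using uV by (auto simp: xs dest: split_list)
    have "as = []"
    proof (rule ccontr)
      assume "as \<noteq> []"
      then have "graph_cycle G (v # as @ [u])"
        using P u unfolding graph_cycle_def xs ys
        by (cases as) (auto simp: successively_append_iff successively_Cons hd_append insert_commute)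
      then show False using acyclic by blast
    qed
    then show ?thesis by (simp add: ys)
  qed
  then show ?thesis using P xs by (intro bexI[of _ v]) auto
qed

text \<open>Induction on the order: delete a vertex with at most one neighbor, split the rest, and
  put the vertex back on the side opposite to its neighbor.\<close>

lemma forest_bipartite:
  assumes "simple_graph G" and "\<nexists>xs. graph_cycle G xs"
  shows "\<exists>A. \<forall>u w. adjacent G u w \<longrightarrow> (u \<in> A) \<noteq> (w \<in> A)"
  using assms
proof (induction "card (verts G)" arbitrary: G)
  case 0
  then have "verts G = {}" by (simp add: simple_graph_def)
  then show ?case using simple_graph_adjacent(1)[OF "0.prems"(1)] by auto
next
  case (Suc n)
  note G = Suc.prems(1)
  have fin: "finite (verts G)" using G by (simp add: simple_graph_def)
  have "verts G \<noteq> {}" using Suc.hyps(2) by auto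
  then obtain v where v: "v \<in> verts G" "\<And>u w. adjacent G v u \<Longrightarrow> adjacent G v w \<Longrightarrow> u = w"
    using forest_leaf[OF Suc.prems] by blast
  define G' where "G' = (verts G - {v}, {e \<in> edges G. v \<notin> e})"
  have "simple_graph G'"
    using G unfolding simple_graph_def G'_def by fastforce
  moreover have "\<nexists>xs. graph_cycle G' xs"
  proof
    assume "\<exists>xs. graph_cycle G' xs"
    then obtain xs where "graph_cycle G' xs" ..
    then have "graph_cycle G xs"
      by (auto simp: graph_cycle_def G'_def elim!: successively_mono)
    then show False using Suc.prems(2) by blast
  qed
  moreover have "n = card (verts G')"
    using Suc.hyps(2) v(1) fin by (simp add: G'_def)
  ultimately obtain A where A: "\<And>u w. adjacent G' u w \<Longrightarrow> (u \<in> A) \<noteq> (w \<in> A)"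
    using Suc.hyps(1) by blast
  have old: "(u \<in> A) \<noteq> (w \<in> A)" if "adjacent G u w" "u \<noteq> v" "w \<noteq> v" for u w
    using A[of u w] that by (auto simp: G'_def)
  define A' where "A' = (if \<exists>u\<in>A. adjacent G v u then A - {v} else insert v A)"
  have new: "(v \<in> A') \<noteq> (w \<in> A')" if "adjacent G v w" for w
  proof (cases "w \<in> A")
    case True
    then show ?thesis using that simple_graph_adjacent(3)[OF G that] by (auto simp: A'_def)
  next
    case False
    then have "\<not> (\<exists>u\<in>A. adjacent G v u)" using v(2)[OF that] by blast
    then show ?thesis using False simple_graph_adjacent(3)[OF G that] by (auto simp: A'_def)
  qed
  have "(u \<in> A') \<noteq> (w \<in> A')" if "adjacent G u w" for u w
  proof (cases "u = v \<or> w = v")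
    case True
    then show ?thesis using new that by (metis insert_commute)
  next
    case False
    then show ?thesis using old[OF that] by (auto simp: A'_def)
  qed
  then show ?case by blast
qed

section \<open>Lower bound from colorings with one monochromatic side\<close>

text \<open>If the middle vertex is in \<open>A\<close>, so are both ends, and at most one of these
  three is \<open>v\<close>; otherwise the second and fourth vertices are in \<open>A\<close> and
  differ from \<open>v\<close>. Either way color \<open>a\<close> repeats. The exceptional vertex
  \<open>v\<close> may lie on either side.\<close>

lemma no_rainbow_path_5_bipartite:
  assumes G: "simple_graph G"
    and A: "\<And>u w. adjacent G u w \<Longrightarrow> (u \<in> A) \<noteq> (w \<in> A)"
    and v: "\<And>u w. adjacent G v u \<Longrightarrow> adjacent G v w \<Longrightarrow> u = w"
    and c: "\<And>u. u \<in> A \<Longrightarrow> u \<noteq> v \<Longrightarrow> c u = a"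
  shows "no_rainbow_path 5 G c"
  unfolding no_rainbow_path_iff[OF G]
proof
  assume "\<exists>xs. length xs = 5 \<and> set xs \<subseteq> verts G \<and> successively (adjacent G) xs \<and> distinct (map c xs)"
  then obtain p q r s t
    where adj: "adjacent G p q" "adjacent G q r" "adjacent G r s" "adjacent G s t"
      and d: "distinct (map c [p, q, r, s, t])"
    by (auto simp: length_Suc_conv eval_nat_numeral)
  \<comment> \<open>An interior vertex has two neighbors on the path, and these differ because their
    colors do.\<close>
  have interior: "q \<noteq> v" "r \<noteq> v" "s \<noteq> v"
    using adj d v[of p r] v[of q s] v[of r t] by (auto simp: insert_commute)
  show False
  proof (cases "r \<in> A")
    case True
    then have "p \<in> A" "t \<in> A" using adj A by blast+
    moreover have "p \<noteq> v \<or> t \<noteq> v" using d by auto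
    ultimately show False using True c[of p] c[of r] c[of t] interior d by auto
  next
    case False
    then have "q \<in> A" "s \<in> A" using adj A by blast+
    then show False using c[of q] c[of s] interior d by auto
  qed
qed

lemma card_le_cp_num:
  assumes "simple_graph G" "proper_coloring G c" "no_rainbow_path k G c"
  shows "card (c ` verts G) \<le> cp_num k G"
  unfolding cp_num_def using assms by (intro Max_ge finite_color_counts) auto

text \<open>The coloring \<open>c\<close> guarantees that the set of counts defining
  \<open>cp_num\<close> is nonempty, so that its \<open>Max\<close> is meaningful.\<close>

lemma cp_num_le_c_num:
  assumes "simple_graph G" "proper_coloring G c" "no_rainbow_path k G c"
  shows "cp_num k G \<le> c_num k G"
  unfolding cp_num_def c_num_def
  using assms by (intro Max_mono finite_color_counts) auto

lemma bipartite_coloring: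
  fixes G :: "'a graph"
  assumes G: "simple_graph G"
    and A: "\<And>u w. adjacent G u w \<Longrightarrow> (u \<in> A) \<noteq> (w \<in> A)"
    and v: "\<And>u w. adjacent G v u \<Longrightarrow> adjacent G v w \<Longrightarrow> u = w"
    and AV: "A \<subseteq> verts G"
  shows "\<exists>c. proper_coloring G c \<and> no_rainbow_path 5 G c \<and>
    card (c ` verts G) = card (verts G - A) + card (A \<inter> {v}) + (if A \<subseteq> {v} then 0 else 1)"
proof -
  have fin: "finite (verts G)" using G by (simp add: simple_graph_def)
  then obtain g :: "'a \<Rightarrow> nat" where g: "inj_on g (verts G)"
    using finite_imp_inj_to_nat_seg by blast
  \<comment> \<open>The shift by 2 keeps the private colors away from 0, shared on \<open>A\<close>,
    and 1, reserved for \<open>v\<close>. In the count below, color 0 is missing exactly when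
    \<open>A\<close> has no vertex besides \<open>v\<close>.\<close>
  define c where "c u = (if u \<in> A then if u = v then 1 else 0 else g u + 2)" for u
  have "proper_coloring G c"
    using A by (fastforce simp: proper_coloring_def c_def)
  moreover have "no_rainbow_path 5 G c"
    using G A v by (rule no_rainbow_path_5_bipartite[where a = 0]) (auto simp: c_def)
  moreover have "card (c ` verts G) =
      card (verts G - A) + card (A \<inter> {v}) + (if A \<subseteq> {v} then 0 else 1)"
  proof -
    let ?B = "(\<lambda>u. g u + 2) ` (verts G - A)"
    let ?C = "(\<lambda>u. 1) ` (A \<inter> {v}) :: nat set"
    let ?D = "(\<lambda>u. 0) ` (A - {v}) :: nat set"
    have "c ` verts G = ?B \<union> ?C \<union> ?D"
      using AV by (force simp: c_def)
    moreover have "card (?B \<union> ?C \<union> ?D) = card ?B + card ?C + card ?D"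
    proof -
      have "finite ?B" "finite ?C" "finite ?D" using fin AV by (auto intro: finite_subset)
      moreover have "?B \<inter> ?C = {}" "(?B \<union> ?C) \<inter> ?D = {}" by auto
      ultimately show ?thesis by (simp only: card_Un_disjoint finite_Un simp_thms)
    qed
    moreover have "card ?B = card (verts G - A)"
      using g by (intro card_image) (auto simp: inj_on_def)
    moreover have "card ?C = card (A \<inter> {v})"
      by (intro card_image) (auto simp: inj_on_def)
    moreover have "card ?D = (if A \<subseteq> {v} then 0 else 1)"
    proof (cases "A \<subseteq> {v}")
      case True
      then have "?D = {}" by blast
      then show ?thesis using True by (simp only: card.empty if_True)
    next
      case False
      then have "?D = {0}" by auto
      then show ?thesis using False by simp
    qed
    ultimately show ?thesis by simp
  qed
  ultimately show ?thesis by blast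
qed

text \<open>Let \<open>A\<close> be the side of the leaf \<open>v\<close> and \<open>B\<close> the
  other one. If \<open>A\<close> is not larger, sharing a color on \<open>A - {v}\<close> gives
  \<open>card B + 2\<close> colors. If \<open>A\<close> is larger, sharing one on \<open>B\<close>
  gives \<open>card A + 1\<close>, and \<open>card A \<ge> card B + 1\<close> makes up for the
  missing private leaf.\<close>

lemma forest_coloring_5:
  assumes G: "simple_graph G" and acyclic: "\<nexists>xs. graph_cycle G xs" and n: "card (verts G) \<ge> 3"
  shows "\<exists>c. proper_coloring G c \<and> no_rainbow_path 5 G c \<and>
    card (verts G) + 3 \<le> 2 * card (c ` verts G)"
proof -
  have fin: "finite (verts G)" using G by (simp add: simple_graph_def)
  have "verts G \<noteq> {}" using n by auto
  then obtain v where v: "v \<in> verts G" "\<And>u w. adjacent G v u \<Longrightarrow> adjacent G v w \<Longrightarrow> u = w"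
    using forest_leaf[OF G acyclic] by blast
  obtain A0 where A0: "\<And>u w. adjacent G u w \<Longrightarrow> (u \<in> A0) \<noteq> (w \<in> A0)"
    using forest_bipartite[OF G acyclic] by blast
  define A where "A = {u \<in> verts G. u \<in> A0 \<longleftrightarrow> v \<in> A0}"
  define B where "B = verts G - A"
  have AB: "A \<subseteq> verts G" "B \<subseteq> verts G" "v \<in> A" "verts G - B = A" "v \<notin> B"
    using v(1) by (auto simp: A_def B_def)
  have finAB: "finite A" "finite B" using AB fin by (auto intro: finite_subset)
  have A: "(u \<in> A) \<noteq> (w \<in> A)" and B: "(u \<in> B) \<noteq> (w \<in> B)" if "adjacent G u w" for u w
    using A0[OF that] simple_graph_adjacent[OF G that] by (auto simp: A_def B_def)
  have sum: "card (verts G) = card A + card B"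
    using fin AB(1) by (simp add: B_def card_Diff_subset finAB card_mono)
  show ?thesis
  proof (cases "card A \<le> card B")
    case True
    obtain c where c: "proper_coloring G c" "no_rainbow_path 5 G c"
      "card (c ` verts G) = card B + card (A \<inter> {v}) + (if A \<subseteq> {v} then 0 else 1)"
      using bipartite_coloring[of G A v] G A v(2) AB(1) unfolding B_def by blast
    \<comment> \<open>In this degenerate case all n vertices get different colors, and
      \<open>2 * n \<ge> n + 3\<close> since \<open>n \<ge> 3\<close>; likewise for empty
      \<open>B\<close> below.\<close>
    have "A = {v}" if "A \<subseteq> {v}" using that AB(3) by auto
    then have "card (verts G) + 3 \<le> 2 * card (c ` verts G)"
      using c(3) sum n True AB(3) by (auto split: if_splits)
    then show ?thesis using c by blast
  next
    case False
    obtain c where c: "proper_coloring G c" "no_rainbow_path 5 G c"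
      "card (c ` verts G) = card A + card (B \<inter> {v}) + (if B \<subseteq> {v} then 0 else 1)"
      using bipartite_coloring[of G B v] G B v(2) AB(2) unfolding AB(4) by blast
    have "B = {}" if "B \<subseteq> {v}" using that AB(5) by auto
    then have "card (verts G) + 3 \<le> 2 * card (c ` verts G)"
      using c(3) sum n False by (auto split: if_splits)
    then show ?thesis using c by blast
  qed
qed

lemma tree_cp_num_ge:
  assumes "is_tree T" "card (verts T) \<ge> 3"
  shows "cp_num 5 T \<le> c_num 5 T" and "card (verts T) + 3 \<le> 2 * cp_num 5 T"
proof -
  have T: "simple_graph T" "\<nexists>xs. graph_cycle T xs" using assms(1) by (auto simp: is_tree_def)
  obtain c where c: "proper_coloring T c" "no_rainbow_path 5 T c"
    "card (verts T) + 3 \<le> 2 * card (c ` verts T)"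
    using forest_coloring_5[OF T assms(2)] by blast
  show "cp_num 5 T \<le> c_num 5 T" "card (verts T) + 3 \<le> 2 * cp_num 5 T"
    using cp_num_le_c_num[OF T(1) c(1,2)] card_le_cp_num[OF T(1) c(1,2)] c(3) by linarith+
qed

section \<open>Spiders and sharpness\<close>

lemma graph_cycle_two_neighbors:
  assumes "graph_cycle G xs" "v \<in> set xs"
  shows "\<exists>u\<in>set xs. \<exists>w\<in>set xs. u \<noteq> w \<and> adjacent G v u \<and> adjacent G v w"
proof -
  let ?n = "length xs"
  have n: "?n \<ge> 3" and d: "distinct xs" and s: "successively (adjacent G) xs"
    and l: "adjacent G (last xs) (hd xs)"
    using assms(1) by (auto simp: graph_cycle_def)
  have ne: "xs \<noteq> []" using n by auto
  obtain i where i: "i < ?n" "v = xs ! i" using assms(2) by (auto simp: in_set_conv_nth)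
  have step: "adjacent G (xs ! j) (xs ! (Suc j))" if "Suc j < ?n" for j
    using s that by (auto simp: successively_conv_nth)
  have close: "adjacent G (xs ! (?n - 1)) (xs ! 0)"
    using l ne by (simp add: last_conv_nth hd_conv_nth)
  \<comment> \<open>The cyclic predecessor and successor of index \<open>i\<close>; they differ
    because the cycle has length at least 3.\<close>
  define p where "p = (if i = 0 then ?n - 1 else i - 1)"
  define q where "q = (if Suc i = ?n then 0 else Suc i)"
  have pq: "p < ?n" "q < ?n" "p \<noteq> q" using n i by (auto simp: p_def q_def)
  have "adjacent G (xs ! p) v"
    using i close step[of "i - 1"] by (auto simp: p_def)
  moreover have "adjacent G v (xs ! q)"
  proof (cases "Suc i = ?n")
    case True
    then have "i = ?n - 1" by simp
    then show ?thesis using True i close by (simp add: q_def)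
  next
    case False
    then show ?thesis using i step[of i] by (simp add: q_def)
  qed
  ultimately show ?thesis
    using pq d by (metis adjacent_sym nth_eq_iff_index_eq nth_mem)
qed

text \<open>Vertex 0 is the center; leg \<open>i\<close> has middle vertex \<open>2 * i + 1\<close>
  and tip \<open>2 * i + 2\<close>. With this numbering every nonzero vertex has exactly one smaller
  neighbor, which yields acyclicity.\<close>

definition spider :: "nat \<Rightarrow> nat graph" where
  "spider k = ({..2 * k}, (\<Union>i<k. {{0, 2 * i + 1}, {2 * i + 1, 2 * i + 2}}))"

lemma simple_graph_spider: "simple_graph (spider k)"
proof -
  have "\<exists>u\<in>verts (spider k). \<exists>v\<in>verts (spider k). u \<noteq> v \<and> e = {u, v}"
    if e: "e \<in> edges (spider k)" for e
  proof -
    obtain i where i: "i < k" "e = {0, 2 * i + 1} \<or> e = {2 * i + 1, 2 * i + 2}"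
      using e unfolding spider_def snd_conv by blast
    then have "{0, 2 * i + 1, 2 * i + 2} \<subseteq> verts (spider k)" by (simp add: spider_def)
    moreover have "0 \<noteq> 2 * i + 1" "2 * i + 1 \<noteq> 2 * i + 2" by simp_all
    ultimately show ?thesis using i(2) by (metis insert_subset)
  qed
  moreover have "finite (verts (spider k))" by (simp add: spider_def)
  ultimately show ?thesis by (simp add: simple_graph_def)
qed

lemma verts_spider: "verts (spider k) = insert 0 (\<Union>i<k. {2 * i + 1, 2 * i + 2})"
  by (induction k) (auto simp: spider_def lessThan_Suc atMost_Suc)

lemma is_tree_spider: "is_tree (spider k)"
proof -
  let ?R = "(adjacent (spider k))\<^sup>*\<^sup>*"
  have adj: "adjacent (spider k) 0 (2 * i + 1)" "adjacent (spider k) (2 * i + 1) (2 * i + 2)"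
    if "i < k" for i
    using that by (auto simp: spider_def)
  have R: "?R 0 u" if u: "u \<in> verts (spider k)" for u
  proof -
    consider "u = 0" | i where "i < k" "u = 2 * i + 1" | i where "i < k" "u = 2 * i + 2"
      using u unfolding verts_spider by blast
    then show ?thesis
    proof cases
      case 2
      then show ?thesis using adj by blast
    next
      case 3
      then show ?thesis using adj by (metis converse_rtranclp_into_rtranclp r_into_rtranclp)
    qed auto
  qed
  have "symp ?R"
    by (intro symp_rtranclp sympI) (simp add: insert_commute)
  then have "?R u w" if "u \<in> verts (spider k)" "w \<in> verts (spider k)" for u w
    using R[OF that(1)] R[OF that(2)] by (meson rtranclp_trans sympD)
  then have "graph_connected (spider k)"
    unfolding graph_connected_def by (auto simp: verts_spider)
  moreover have "\<not> graph_cycle (spider k) xs" for xs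
  proof
    assume cyc: "graph_cycle (spider k) xs"
    \<comment> \<open>No vertex has two smaller neighbors, but the largest one on a cycle has.\<close>
    then have "Max (set xs) \<in> set xs" by (intro Max_in) (auto simp: graph_cycle_def)
    then obtain M u w where "u \<le> M" "w \<le> M" "u \<noteq> w"
      "adjacent (spider k) M u" "adjacent (spider k) M w"
      using graph_cycle_two_neighbors[OF cyc] by (metis List.finite_set Max_ge)
    then show False
      by (auto simp: spider_def doubleton_eq_iff) presburger+
  qed
  ultimately show ?thesis using simple_graph_spider by (auto simp: is_tree_def)
qed

lemma spider_coloring_le:
  assumes c: "no_rainbow_path 5 (spider k) c" and "k > 0"
  shows "card (c ` verts (spider k)) \<le> k + 2"
proof -
  define full where "full i \<longleftrightarrow> distinct [c 0, c (2 * i + 1), c (2 * i + 2)]" for i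
  \<comment> \<open>Leg \<open>j\<close> is full whenever some leg is; if none is, any leg will do,
    and \<open>k > 0\<close> provides one.\<close>
  obtain j where j: "j < k" "\<And>i. i < k \<Longrightarrow> full i \<Longrightarrow> full j"
    using \<open>k > 0\<close> by blast
  let ?S = "{c 0, c (2 * j + 1), c (2 * j + 2)}"
  \<comment> \<open>Leg \<open>i\<close> adds at most one color to \<open>?S\<close>. If it is full,
    so is \<open>j\<close>, and the color repeated on the path through both legs is common to leg
    \<open>i\<close> and leg \<open>j\<close>. If it is not full, its two colors coincide or one of
    them is that of the center.\<close>
  have "\<exists>x. {c (2 * i + 1), c (2 * i + 2)} \<subseteq> insert x ?S" if i: "i < k" "i \<noteq> j" for i
  proof (cases "full i")
    case True
    let ?xs = "[2 * i + 2, 2 * i + 1, 0, 2 * j + 1, 2 * j + 2]"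
    have "set ?xs \<subseteq> verts (spider k)" "successively (adjacent (spider k)) ?xs"
      using i j(1) by (auto simp: spider_def insert_commute)
    moreover have "length ?xs = 5" by simp
    ultimately have "\<not> distinct (map c ?xs)"
      using c unfolding no_rainbow_path_iff[OF simple_graph_spider] by blast
    then show ?thesis using True j(2)[OF i(1) True] by (auto simp: full_def)
  next
    case False
    then show ?thesis by (auto simp: full_def)
  qed
  then have "\<forall>i\<in>{..<k} - {j}. \<exists>x. {c (2 * i + 1), c (2 * i + 2)} \<subseteq> insert x ?S"
    by simp
  from bchoice[OF this] obtain x
    where x: "\<And>i. i \<in> {..<k} - {j} \<Longrightarrow> {c (2 * i + 1), c (2 * i + 2)} \<subseteq> insert (x i) ?S"
    by blast
  have "c ` verts (spider k) \<subseteq> ?S \<union> x ` ({..<k} - {j})"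
  proof
    fix y assume "y \<in> c ` verts (spider k)"
    then obtain u where u: "u \<in> verts (spider k)" "y = c u" by blast
    consider "u = 0" | i where "i < k" "u \<in> {2 * i + 1, 2 * i + 2}"
      using u(1) unfolding verts_spider by blast
    then show "y \<in> ?S \<union> x ` ({..<k} - {j})"
    proof cases
      case (2 i)
      show ?thesis
      proof (cases "i = j")
        case True
        then show ?thesis using 2(2) u(2) by auto
      next
        case False
        then show ?thesis using x[of i] 2 u(2) by auto
      qed
    qed (auto simp: u)
  qed
  then have "card (c ` verts (spider k)) \<le> card (?S \<union> x ` ({..<k} - {j}))"
    by (intro card_mono) auto
  also have "\<dots> \<le> card ?S + card (x ` ({..<k} - {j}))" by (rule card_Un_le)
  \<comment> \<open>Three colors at most from the center and leg \<open>j\<close>, and one from each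
    of the other \<open>k - 1\<close> legs.\<close>
  also have "\<dots> \<le> 3 + card ({..<k} - {j})"
    by (intro add_mono card_image_le) (auto simp: card_insert_if)
  also have "\<dots> = k + 2" using j(1) by simp
  finally show ?thesis .
qed

theorem theorem9:
  shows "(\<forall>T :: 'a graph. is_tree T \<and> card (verts T) \<ge> 3 \<longrightarrow>
            c_num 5 T \<ge> cp_num 5 T \<and>
            real (cp_num 5 T) \<ge> (real (card (verts T)) + 3) / 2) \<and>
         (\<forall>N. \<exists>T :: nat graph. is_tree T \<and> card (verts T) \<ge> N \<and>
            c_num 5 T = cp_num 5 T \<and>
            real (cp_num 5 T) = (real (card (verts T)) + 3) / 2)"
proof -
  have "\<exists>T :: nat graph. is_tree T \<and> card (verts T) \<ge> N \<and> c_num 5 T = cp_num 5 T \<and>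
      real (cp_num 5 T) = (real (card (verts T)) + 3) / 2" for N
  proof -
    \<comment> \<open>The successor makes \<open>k\<close> positive, so the order
      \<open>2 * k + 1\<close> is at least 3 even for \<open>N = 0\<close>.\<close>
    define k where "k = Suc N"
    have card: "card (verts (spider k)) = 2 * k + 1" by (simp add: spider_def)
    then have large: "card (verts (spider k)) \<ge> 3" by (simp add: k_def)
    \<comment> \<open>The constant coloring shows that the set under \<open>Max\<close> in
      \<open>c_num\<close> is nonempty, as \<open>Max_le_iff\<close> requires.\<close>
    have "no_rainbow_path 5 (spider k) (\<lambda>_. 0)"
      unfolding no_rainbow_path_iff[OF simple_graph_spider]
      by (auto simp: length_Suc_conv eval_nat_numeral)
    then have "c_num 5 (spider k) \<le> k + 2"
      unfolding c_num_def
      using spider_coloring_le[of k] finite_color_counts[OF simple_graph_spider]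
      by (subst Max_le_iff) (auto simp: k_def)
    moreover have "cp_num 5 (spider k) \<le> c_num 5 (spider k)" "k + 2 \<le> cp_num 5 (spider k)"
      using tree_cp_num_ge[OF is_tree_spider large] unfolding card by auto
    ultimately show ?thesis
      using is_tree_spider[of k] card by (intro exI[of _ "spider k"]) (auto simp: k_def)
  qed
  moreover have "real (cp_num 5 T) \<ge> (real (card (verts T)) + 3) / 2"
    if "is_tree T" "card (verts T) \<ge> 3" for T :: "'a graph"
    using of_nat_mono[OF tree_cp_num_ge(2)[OF that], where ?'a = real] by simp
  ultimately show ?thesis using tree_cp_num_ge(1) by blast
qed

end
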